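(* Consider human ratings generated by a rating model $h$ of degree $q$ as described in the context, with noise level $\sigma$, reward bound $R$ and variance bound $V_{R,\sigma}^2$. For any fixed constant $0<\delta<1$, there exists a contextual bandit instance with initial state distribution $\rho$ such that if one samples a dataset $\mathcal D$ of size $n\ge\max\{48\sigma^4,60\}$ using a sampling distribution $d$ satisfying the full coverage assumption ($d(s,a)>0$ for any $(s,a)\in\mathcal S\times\mathcal A$) with $d(s,a)=\frac1{SA}$ for every $s\in\mathcal S$ and $a\in\mathcal A$, and runs the LCB algorithm with penalty $b_m=c_b\sqrt{\widetilde V_{R,\sigma}^2\log(SA/\delta)/m}$ on $\mathcal D$, the output policy $\widehat\pi_{\rm LCB}$ must suffer suboptimality at least $$\mathbb E_{\mathcal D}\big[\mathrm{SubOpt}(\widehat\pi_{\rm LCB})\big]\ \ge\ c_0\cdot\bar h^{-1}\!\left(\sqrt{\frac{V_{R,\sigma}^2}{n}}\right),$$ where $c_0>0$ is a constant that depends on $q$.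
   Context: Contextual bandit: $(\mathcal S,\mathcal A,r,\rho)$ with $\mathcal S=\{1,\dots,S\}$, $\mathcal A=\{1,\dots,A\}$, unknown deterministic reward $r:\mathcal S\times\mathcal A\to[0,R]$, and initial state distribution $\rho$. A policy is $\pi:\mathcal S\to\Delta(\mathcal A)$; $\pi^\star$ denotes an optimal policy (maximizing $\mathbb E_{a\sim\pi(\cdot|s)}[r(s,a)]$ for all $s$ simultaneously). $\mathrm{SubOpt}(\pi)=\mathbb E_{s\sim\rho}\big[\mathbb E_{a\sim\pi^\star(\cdot|s)}r(s,a)-\mathbb E_{a\sim\pi(\cdot|s)}r(s,a)\big]$. Rating model: a human rating of $(s,a)$ is $h(r(s,a),\epsilon)$, where $h$ is a deterministic function and $\epsilon\sim\mathcal N(0,\sigma^2)$ is independent of $(s,a)$. Put $\bar h(r)=\mathbb E_\epsilon[h(r,\epsilon)]$. It is assumed that: 1. $\bar h$ maps $[0,R]$ into $[0,R]$, is strictly increasing, and $\bar h(0)=0$. 2. For every $r\in[0,R]$, $h(r,\epsilon)$ is a degree-$q$ polynomial in $\epsilon$, and $-(h(r,\epsilon)-\mathbb E[h(r,\epsilon)])$ has the same distribution as $h(r,\epsilon)-\mathbb E[h(r,\epsilon)]$. 3. There are positive constants $C_{h,1},C_{h,2}$ such that for all $r_1\ge r_2$ in $[0,R]$: $\bar h^{-1}(r_1)-\bar h^{-1}(r_2)\le C_{h,1}\bar h^{-1}(r_1-r_2)$ and $\bar h(r_1)-\bar h(r_2)\le C_{h,2}\bar h(r_1-r_2)$. $V_{R,\sigma}^2$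 is an upper bound on $\mathrm{Var}_\epsilon(h(r,\epsilon))$ over all $r\in[0,R]$ (it can depend on $R$ and $\sigma$). The learner does not know $h$ but has an estimate $\widetilde V_{R,\sigma}^2=c_VV_{R,\sigma}^2$, where $c_V>0$ is an absolute constant; $c_b$ is an appropriately chosen constant in the penalty. Dataset: $\mathcal D=\{(s_i,a_i,\widetilde r_i)\}_{i=1}^n$ with $(s_i,a_i)$ i.i.d. from $d$ and $\widetilde r_i=h(r(s_i,a_i),\epsilon_i)$, with $\epsilon_i$ i.i.d. $\mathcal N(0,\sigma^2)$. LCB algorithm (input $\mathcal D$, $\delta$): for each $(s,a)$ let $n_{(s,a)}$ be the number of $i$ with $(s_i,a_i)=(s,a)$, let $\widetilde r(s,a)=\frac1{n_{(s,a)}}\sum_{i}\widetilde r_i\mathbf 1\{(s_i,a_i)=(s,a)\}$, and $\widehat r(s,a)=\max\{\widetilde r(s,a)-b_{n_{(s,a)}},0\}$ (with $\widehat r(s,a)=0$ if $n_{(s,a)}=0$). Output $\widehat\pi_{\rm LCB}(s)=\arg\max_{a}\widehat r(s,a)$.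
   Formalization: The reward function (and optimal policy) of the instance may depend on n, while S, A and ρ do not; a single instance for all n is impossible, e.g. for h(r,ε)=r+ε, where LCB's suboptimality on a fixed instance decays exponentially in n. *)

theory Defs
  imports "HOL-Probability.Probability"
begin

text \<open>States are \<open>{1..S}\<close> and actions are \<open>{1..A}\<close>; values of functions at other
  indices are irrelevant.\<close>

definition contextual_bandit ::
  "nat \<Rightarrow> nat \<Rightarrow> real \<Rightarrow> (nat \<Rightarrow> nat \<Rightarrow> real) \<Rightarrow> nat pmf \<Rightarrow> bool" where
  "contextual_bandit S A R r \<rho> \<longleftrightarrow>
     1 \<le> S \<and> 1 \<le> A \<and> (\<forall>s\<in>{1..S}. \<forall>a\<in>{1..A}. r s a \<in> {0..R}) \<and> set_pmf \<rho> \<subseteq> {1..S}"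

definition is_policy :: "nat \<Rightarrow> nat \<Rightarrow> (nat \<Rightarrow> nat pmf) \<Rightarrow> bool" where
  "is_policy S A \<pi> \<longleftrightarrow> (\<forall>s\<in>{1..S}. set_pmf (\<pi> s) \<subseteq> {1..A})"

definition optimal_policy ::
  "nat \<Rightarrow> nat \<Rightarrow> (nat \<Rightarrow> nat \<Rightarrow> real) \<Rightarrow> (nat \<Rightarrow> nat pmf) \<Rightarrow> bool" where
  "optimal_policy S A r \<pi>opt \<longleftrightarrow> is_policy S A \<pi>opt \<and>
     (\<forall>\<pi>. is_policy S A \<pi> \<longrightarrow>
        (\<forall>s\<in>{1..S}. measure_pmf.expectation (\<pi> s) (r s) \<le> measure_pmf.expectation (\<pi>opt s) (r s)))"

definition SubOpt ::
  "nat pmf \<Rightarrow> (nat \<Rightarrow> nat \<Rightarrow> real) \<Rightarrow> (nat \<Rightarrow> nat pmf) \<Rightarrow> (nat \<Rightarrow> nat pmf) \<Rightarrow> real" where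
  "SubOpt \<rho> r \<pi>opt \<pi> = measure_pmf.expectation \<rho>
     (\<lambda>s. measure_pmf.expectation (\<pi>opt s) (r s) - measure_pmf.expectation (\<pi> s) (r s))"


definition gaussian :: "real \<Rightarrow> real measure" where
  "gaussian \<sigma> = density lborel (normal_density 0 \<sigma>)"

definition hbar :: "real \<Rightarrow> (real \<Rightarrow> real \<Rightarrow> real) \<Rightarrow> real \<Rightarrow> real" where
  "hbar \<sigma> h r = prob_space.expectation (gaussian \<sigma>) (h r)"

text \<open>The inverse of \<open>hbar\<close> on \<open>{0..R}\<close>. Writing it as a supremum also gives a meaning to the
  inverse at points \<open>y \<ge> 0\<close> outside the range of \<open>hbar\<close> (in particular the value \<open>R\<close> for large
  \<open>y\<close>); on the range it is the ordinary inverse function, see \<open>hbar_inv_eq\<close> below.\<close>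

definition hbar_inv :: "real \<Rightarrow> real \<Rightarrow> (real \<Rightarrow> real \<Rightarrow> real) \<Rightarrow> real \<Rightarrow> real" where
  "hbar_inv \<sigma> R h y = Sup {r\<in>{0..R}. hbar \<sigma> h r \<le> y}"

lemma hbar_inv_eq:
  assumes mono: "strict_mono_on {0..R} (hbar \<sigma> h)" and y: "y \<in> hbar \<sigma> h ` {0..R}"
  shows "hbar_inv \<sigma> R h y = the_inv_into {0..R} (hbar \<sigma> h) y"
proof -
  obtain x where x: "x \<in> {0..R}" and yx: "y = hbar \<sigma> h x"
    using y by blast
  have "{r\<in>{0..R}. hbar \<sigma> h r \<le> y} = {0..x}"
    using x strict_mono_on_less_eq[OF mono _ x] by (auto simp: yx)
  moreover have "the_inv_into {0..R} (hbar \<sigma> h) y = x"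
    using the_inv_into_f_f[OF strict_mono_on_imp_inj_on[OF mono] x] by (simp add: yx)
  ultimately show ?thesis
    using x by (simp add: hbar_inv_def)
qed

definition rating_model ::
  "nat \<Rightarrow> real \<Rightarrow> real \<Rightarrow> (real \<Rightarrow> real \<Rightarrow> real) \<Rightarrow> real \<Rightarrow> real \<Rightarrow> bool" where
  "rating_model q \<sigma> R h C1 C2 \<longleftrightarrow>
     0 < \<sigma> \<and> 0 \<le> R \<and>
     hbar \<sigma> h ` {0..R} \<subseteq> {0..R} \<and> strict_mono_on {0..R} (hbar \<sigma> h) \<and> hbar \<sigma> h 0 = 0 \<and>
     (\<forall>r\<in>{0..R}.
        (\<exists>p :: real poly. degree p = q \<and> h r = poly p) \<and>
        distr (gaussian \<sigma>) borel (\<lambda>e. - (h r e - hbar \<sigma> h r)) =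
        distr (gaussian \<sigma>) borel (\<lambda>e. h r e - hbar \<sigma> h r)) \<and>
     0 < C1 \<and> 0 < C2 \<and>
     (\<forall>r1\<in>{0..R}. \<forall>r2\<in>{0..R}. r2 \<le> r1 \<longrightarrow>
        hbar_inv \<sigma> R h r1 - hbar_inv \<sigma> R h r2 \<le> C1 * hbar_inv \<sigma> R h (r1 - r2) \<and>
        hbar \<sigma> h r1 - hbar \<sigma> h r2 \<le> C2 * hbar \<sigma> h (r1 - r2))"

definition variance_bound :: "real \<Rightarrow> real \<Rightarrow> (real \<Rightarrow> real \<Rightarrow> real) \<Rightarrow> real \<Rightarrow> bool" where
  "variance_bound \<sigma> R h V \<longleftrightarrow> (\<forall>r\<in>{0..R}. prob_space.variance (gaussian \<sigma>) (h r) \<le> V\<^sup>2)"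


text \<open>The underlying randomness \<open>((s\<^sub>i, a\<^sub>i), \<epsilon>\<^sub>i)\<close>, \<open>i = 1..n\<close>, and the rated dataset
  \<open>(s\<^sub>i, a\<^sub>i, h (r s\<^sub>i a\<^sub>i) \<epsilon>\<^sub>i)\<close> built from it.\<close>

definition sample_space ::
  "nat \<Rightarrow> (nat \<times> nat) pmf \<Rightarrow> real \<Rightarrow> (nat \<Rightarrow> (nat \<times> nat) \<times> real) measure" where
  "sample_space n d \<sigma> = PiM {1..n} (\<lambda>_. measure_pmf d \<Otimes>\<^sub>M gaussian \<sigma>)"

definition rated_data ::
  "(real \<Rightarrow> real \<Rightarrow> real) \<Rightarrow> (nat \<Rightarrow> nat \<Rightarrow> real) \<Rightarrow> (nat \<Rightarrow> (nat \<times> nat) \<times> real)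
     \<Rightarrow> nat \<Rightarrow> (nat \<times> nat) \<times> real" where
  "rated_data h r \<omega> i = (case \<omega> i of ((s, a), e) \<Rightarrow> ((s, a), h (r s a) e))"

definition full_coverage :: "nat \<Rightarrow> nat \<Rightarrow> (nat \<times> nat) pmf \<Rightarrow> bool" where
  "full_coverage S A d \<longleftrightarrow> (\<forall>s\<in>{1..S}. \<forall>a\<in>{1..A}. 0 < pmf d (s, a))"


definition count_sa :: "nat \<Rightarrow> (nat \<Rightarrow> (nat \<times> nat) \<times> real) \<Rightarrow> nat \<Rightarrow> nat \<Rightarrow> nat" where
  "count_sa n D s a = card {i\<in>{1..n}. fst (D i) = (s, a)}"

definition mean_rating :: "nat \<Rightarrow> (nat \<Rightarrow> (nat \<times> nat) \<times> real) \<Rightarrow> nat \<Rightarrow> nat \<Rightarrow> real" where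
  "mean_rating n D s a =
     (\<Sum>i\<in>{i\<in>{1..n}. fst (D i) = (s, a)}. snd (D i)) / real (count_sa n D s a)"

definition lcb_reward ::
  "(nat \<Rightarrow> real) \<Rightarrow> nat \<Rightarrow> (nat \<Rightarrow> (nat \<times> nat) \<times> real) \<Rightarrow> nat \<Rightarrow> nat \<Rightarrow> real" where
  "lcb_reward b n D s a =
     (if count_sa n D s a = 0 then 0
      else max (mean_rating n D s a - b (count_sa n D s a)) 0)"

text \<open>The argmax in the algorithm may not be unique; ties are resolved by a fixed rule that depends on
  the state and the set of maximizers only.\<close>

definition tie_breaking :: "(nat \<Rightarrow> nat set \<Rightarrow> nat) \<Rightarrow> bool" where
  "tie_breaking tie \<longleftrightarrow> (\<forall>s T. T \<noteq> {} \<longrightarrow> tie s T \<in> T)"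

definition lcb_policy ::
  "(nat \<Rightarrow> nat set \<Rightarrow> nat) \<Rightarrow> nat \<Rightarrow> (nat \<Rightarrow> real) \<Rightarrow> nat \<Rightarrow> (nat \<Rightarrow> (nat \<times> nat) \<times> real)
     \<Rightarrow> nat \<Rightarrow> nat pmf" where
  "lcb_policy tie A b n D s =
     return_pmf (tie s {a. is_arg_max (lcb_reward b n D s) (\<lambda>a. a \<in> {1..A}) a})"

definition penalty :: "real \<Rightarrow> real \<Rightarrow> nat \<Rightarrow> nat \<Rightarrow> real \<Rightarrow> nat \<Rightarrow> real" where
  "penalty cb Vest_sq S A \<delta> m = cb * sqrt (Vest_sq * ln (real (S * A) / \<delta>) / real m)"

definition expected_SubOpt_lcb ::
  "(nat \<Rightarrow> nat set \<Rightarrow> nat) \<Rightarrow> nat \<Rightarrow> nat pmf \<Rightarrow> (nat \<Rightarrow> nat \<Rightarrow> real) \<Rightarrow> (nat \<Rightarrow> nat pmf) \<Rightarrow>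
     (real \<Rightarrow> real \<Rightarrow> real) \<Rightarrow> real \<Rightarrow> (nat \<times> nat) pmf \<Rightarrow> (nat \<Rightarrow> real) \<Rightarrow> nat \<Rightarrow> real" where
  "expected_SubOpt_lcb tie A \<rho> r \<pi>opt h \<sigma> d b n =
     prob_space.expectation (sample_space n d \<sigma>)
       (\<lambda>\<omega>. SubOpt \<rho> r \<pi>opt (lcb_policy tie A b n (rated_data h r \<omega>)))"

end

theory Submission
  imports Defs
begin

text \<open>
  The number of actions may be chosen after all parameters except \<open>n\<close>. With one state and \<open>A\<close> so
  large that \<open>c\<^sub>b\<^sup>2 c\<^sub>V ln (A / \<delta>) \<ge> 1\<close>, the penalty satisfies \<open>b\<^sub>m \<ge> \<bar>V\<bar> / sqrt m \<ge> \<bar>V\<bar> / sqrt n\<close>.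
  Give a single arm a reward \<open>x\<close> with \<open>hbar x \<le> \<bar>V\<bar> / sqrt n\<close> and all other arms the reward 0, where
  the good arm is not the one that the tie-breaking rule selects when all estimates vanish.
  The total noise observed on the good arm is symmetric, hence nonpositive with probability at
  least 1/2; on that event the penalised estimate of the good arm is 0, so that arm is not
  chosen and the loss is \<open>x\<close>. As \<open>hbar\<close> may jump, \<open>x\<close> is only taken within a factor
  2 of the supremum defining \<open>hbar_inv\<close>, which gives the constant 1/4.
\<close>

section \<open>Symmetry of the observed noise\<close>

text \<open>By symmetry the events \<open>X \<le> 0\<close> and \<open>X \<ge> 0\<close> are equally
  likely, and together they cover the space.\<close>

lemma (in prob_space) prob_nonpos_ge_half:
  assumes X [measurable]: "X \<in> borel_measurable M"
    and sym: "distr M borel X = distr M borel (\<lambda>x. - X x)"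
  shows "1 / 2 \<le> prob {x \<in> space M. X x \<le> (0 :: real)}"
proof -
  have "prob {x \<in> space M. X x \<le> 0} = measure (distr M borel X) {..0}"
    by (subst measure_distr) (auto intro!: arg_cong[where f = prob])
  also have "\<dots> = measure (distr M borel (\<lambda>x. - X x)) {..0}"
    by (simp only: sym)
  also have "\<dots> = prob {x \<in> space M. 0 \<le> X x}"
    by (subst measure_distr) (auto intro!: arg_cong[where f = prob])
  finally have eq: "prob {x \<in> space M. X x \<le> 0} = prob {x \<in> space M. 0 \<le> X x}" .
  have "1 = prob ({x \<in> space M. X x \<le> 0} \<union> {x \<in> space M. 0 \<le> X x})"
    unfolding prob_space[symmetric] by (rule arg_cong[where f = prob]) auto
  also have "\<dots> \<le> prob {x \<in> space M. X x \<le> 0} + prob {x \<in> space M. 0 \<le> X x}"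
    by (rule measure_Un_le) measurable
  finally show ?thesis
    using eq by simp
qed

text \<open>The law of a sum of independent copies depends on \<open>g\<close> only through the law
  of \<open>g\<close> under \<open>N\<close>, and \<open>g\<close> and \<open>-g\<close> share that
  law.\<close>

lemma distr_PiM_sum_symmetric:
  fixes g :: "'a \<Rightarrow> real"
  assumes N: "prob_space N" and I: "finite I" and g [measurable]: "g \<in> borel_measurable N"
    and sym: "distr N borel g = distr N borel (\<lambda>x. - g x)"
  shows "distr (PiM I (\<lambda>_. N)) borel (\<lambda>\<omega>. \<Sum>i\<in>I. g (\<omega> i)) =
    distr (PiM I (\<lambda>_. N)) borel (\<lambda>\<omega>. - (\<Sum>i\<in>I. g (\<omega> i)))"
proof -
  have push: "distr (PiM I (\<lambda>_. N)) borel (\<lambda>\<omega>. \<Sum>i\<in>I. f (\<omega> i)) =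
      distr (PiM I (\<lambda>_. distr N borel f)) borel (\<lambda>x. \<Sum>i\<in>I. x i)"
    if f [measurable]: "f \<in> borel_measurable N" for f :: "'a \<Rightarrow> real"
  proof -
    \<comment> \<open>The push-forward rule for products is applied with the probability space
      \<open>distr N borel f\<close> as target measure. It has the same sets as
      \<open>borel\<close>, to which the target is changed afterwards.\<close>
    have "distr N (distr N borel f) f = distr N borel f"
      by (rule distr_cong) auto
    then have "PiM I (\<lambda>_. distr N borel f) =
        distr (PiM I (\<lambda>_. N)) (PiM I (\<lambda>_. distr N borel f)) (compose I f)"
      using distr_PiM_finite_prob_space'[of I "\<lambda>_. N" "\<lambda>_. distr N borel f" f] I N f
      by (simp add: prob_space.prob_space_distr)
    also have "\<dots> = distr (PiM I (\<lambda>_. N)) (PiM I (\<lambda>_. borel)) (compose I f)"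
      by (intro distr_cong sets_PiM_cong) auto
    finally have "PiM I (\<lambda>_. distr N borel f) =
        distr (PiM I (\<lambda>_. N)) (PiM I (\<lambda>_. borel)) (compose I f)" .
    moreover have "compose I f \<in> PiM I (\<lambda>_. N) \<rightarrow>\<^sub>M PiM I (\<lambda>_. borel)"
      unfolding compose_def by measurable
    ultimately show ?thesis
      by (simp add: distr_distr o_def compose_def cong: sum.cong)
  qed
  show ?thesis
    using push[of g] push[of "\<lambda>x. - g x"] by (simp add: sym sum_negf)
qed

text \<open>One sample contributes its noise only when its state-action pair lies in
  \<open>B\<close>. The pair is independent of the noise, so this contribution depends in law only
  on the law of the noise and inherits its symmetry.\<close>

lemma distr_pair_indicator_symmetric:
  fixes Y :: "'b \<Rightarrow> real"
  assumes M: "prob_space M" and N: "prob_space N"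
    and Y [measurable]: "Y \<in> borel_measurable N" and B [measurable]: "B \<in> sets M"
    and sym: "distr N borel Y = distr N borel (\<lambda>x. - Y x)"
  shows "distr (M \<Otimes>\<^sub>M N) borel (\<lambda>(z, e). indicator B z * Y e) =
    distr (M \<Otimes>\<^sub>M N) borel (\<lambda>(z, e). - (indicator B z * Y e))"
proof -
  have push: "distr (M \<Otimes>\<^sub>M N) borel (\<lambda>(z, e). indicator B z * f e) =
      distr (M \<Otimes>\<^sub>M distr N borel f) borel (\<lambda>(z, y). indicator B z * y)"
    if f [measurable]: "f \<in> borel_measurable N" for f :: "'b \<Rightarrow> real"
  proof -
    have "M \<Otimes>\<^sub>M distr N borel f = distr M M (\<lambda>z. z) \<Otimes>\<^sub>M distr N borel f"
      by simp
    also have "\<dots> = distr (M \<Otimes>\<^sub>M N) (M \<Otimes>\<^sub>M borel) (\<lambda>(z, e). (z, f e))"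
      by (rule pair_measure_distr)
        (auto intro!: prob_space_imp_sigma_finite prob_space.prob_space_distr N)
    finally show ?thesis
      by (simp add: distr_distr o_def split_beta')
  qed
  show ?thesis
    using push[of Y] push[of "\<lambda>x. - Y x"] by (simp add: sym)
qed

section \<open>Measurability of the estimates and of the set of maximizers\<close>

lemma measurable_lcb_reward:
  assumes [measurable]: "\<And>i. i \<in> {1..n} \<Longrightarrow> (\<lambda>\<omega>. fst (D \<omega> i)) \<in> M \<rightarrow>\<^sub>M count_space UNIV"
    and [measurable]: "\<And>i. i \<in> {1..n} \<Longrightarrow> (\<lambda>\<omega>. snd (D \<omega> i)) \<in> borel_measurable M"
  shows "(\<lambda>\<omega>. lcb_reward b n (D \<omega>) s a) \<in> borel_measurable M"
proof -
  \<comment> \<open>The index set of the visits depends on the data. Both sums are rewritten over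
    the fixed set \<open>{1..n}\<close>, so that only the summands are random.\<close>
  have count: "count_sa n D' s a = (\<Sum>i\<in>{1..n}. if fst (D' i) = (s, a) then 1 else 0)" for D'
    unfolding count_sa_def by (simp add: sum.If_cases Int_def)
  have mean: "(\<Sum>i\<in>{i\<in>{1..n}. fst (D' i) = (s, a)}. snd (D' i)) =
      (\<Sum>i\<in>{1..n}. if fst (D' i) = (s, a) then snd (D' i) else 0)"
    for D' :: "nat \<Rightarrow> (nat \<times> nat) \<times> real"
    by (simp add: sum.If_cases Int_def)
  have [measurable]: "(\<lambda>\<omega>. count_sa n (D \<omega>) s a) \<in> M \<rightarrow>\<^sub>M count_space UNIV"
    unfolding count by measurable
  have [measurable]: "(\<lambda>\<omega>. \<Sum>i\<in>{i\<in>{1..n}. fst (D \<omega> i) = (s, a)}. snd (D \<omega> i)) \<in> borel_measurable M"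
    unfolding mean by measurable
  show ?thesis
    unfolding lcb_reward_def mean_rating_def by measurable
qed

text \<open>The tie-breaking rule is an arbitrary function of the set of maximizers, so the set
  itself has to be measurable into a discrete space. It takes finitely many values, and each
  preimage is given by finitely many comparisons.\<close>

lemma measurable_argmax_set:
  fixes f :: "'b \<Rightarrow> 'a \<Rightarrow> real"
  assumes F: "finite F" and f [measurable]: "\<And>a. (\<lambda>\<omega>. f \<omega> a) \<in> borel_measurable M"
  shows "(\<lambda>\<omega>. {a. is_arg_max (f \<omega>) (\<lambda>a. a \<in> F) a}) \<in> M \<rightarrow>\<^sub>M count_space UNIV"
proof -
  let ?T = "\<lambda>\<omega>. {a. is_arg_max (f \<omega>) (\<lambda>a. a \<in> F) a}"
  have "?T \<in> M \<rightarrow>\<^sub>M count_space (Pow F)"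
  proof (rule measurable_count_space_eq2[THEN iffD2])
    show "finite (Pow F)" using F by simp
    have "?T -` {B} \<inter> space M \<in> sets M" if "B \<in> Pow F" for B
    proof -
      have "?T -` {B} \<inter> space M =
        {\<omega> \<in> space M. \<forall>a\<in>F. (\<forall>y\<in>F. \<not> f \<omega> a < f \<omega> y) \<longleftrightarrow> a \<in> B}"
        using that by (auto simp: is_arg_max_def set_eq_iff)
      also have "\<dots> \<in> sets M"
        using F by measurable
      finally show ?thesis .
    qed
    then show "?T \<in> space M \<rightarrow> Pow F \<and> (\<forall>B\<in>Pow F. ?T -` {B} \<inter> space M \<in> sets M)"
      by (auto simp: is_arg_max_def)
  qed
  then show ?thesis
    by (rule measurable_compose) simp
qed

section \<open>Estimates, penalty and the arm chosen by LCB\<close>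

text \<open>Estimates are nonnegative, so an arm with estimate 0 can be a maximizer only if all
  estimates vanish. Then every arm is a maximizer, and the rule picks \<open>tie s {1..A}\<close>,
  which is not \<open>a1\<close>.\<close>

lemma lcb_reward_zero_not_chosen:
  assumes tie: "tie_breaking tie" and a1: "a1 \<in> {1..A}" "a1 \<noteq> tie s {1..A}"
    and zero: "lcb_reward b n D s a1 = 0"
  shows "tie s {a. is_arg_max (lcb_reward b n D s) (\<lambda>a. a \<in> {1..A}) a} \<noteq> a1"
    (is "tie s ?T \<noteq> a1")
proof
  assume chosen: "tie s ?T = a1"
  have nonneg: "0 \<le> lcb_reward b n D s a" for a
    by (simp add: lcb_reward_def)
  \<comment> \<open>\<open>tie_breaking\<close> constrains the rule on nonempty sets only.\<close>
  have "?T \<noteq> {}"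
  proof -
    have "Max (lcb_reward b n D s ` {1..A}) \<in> lcb_reward b n D s ` {1..A}"
      using a1 by (intro Max_in) auto
    then obtain a where a: "a \<in> {1..A}"
        "lcb_reward b n D s a = Max (lcb_reward b n D s ` {1..A})"
      by (metis imageE)
    then have "lcb_reward b n D s y \<le> lcb_reward b n D s a" if "y \<in> {1..A}" for y
      using that by simp
    then have "a \<in> ?T"
      using a(1) by (fastforce simp: is_arg_max_def not_less)
    then show ?thesis by blast
  qed
  then have "a1 \<in> ?T"
    using tie chosen by (metis tie_breaking_def)
  then have "lcb_reward b n D s y = 0" if "y \<in> {1..A}" for y
    using that zero nonneg[of y] by (auto simp: is_arg_max_def not_less intro: antisym)
  then have "?T = {1..A}"
    by (auto simp: is_arg_max_def)
  then show False
    using chosen a1 by simp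
qed

text \<open>The size of \<open>A\<close> makes the factor
  \<open>cb\<^sup>2 * cV * ln (A / \<delta>)\<close> under the square root at least 1. For
  \<open>m = 0\<close> both sides are 0, because division by zero gives 0.\<close>

lemma penalty_dominates:
  assumes "0 < cV" "0 < cb" "0 < \<delta>" "\<delta> < 1" "1 \<le> A" "exp (1 / (cb\<^sup>2 * cV)) \<le> real A"
  shows "\<bar>V\<bar> / sqrt (real m) \<le> penalty cb (cV * V\<^sup>2) 1 A \<delta> m"
proof -
  have "1 / (cb\<^sup>2 * cV) \<le> ln (real A)"
    using assms by (simp add: ln_ge_iff)
  also have "\<dots> \<le> ln (real A / \<delta>)"
    using assms by (subst ln_le_cancel_iff) (auto simp: field_simps)
  finally have "1 \<le> cb\<^sup>2 * cV * ln (real A / \<delta>)"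
    using assms by (simp add: field_simps)
  then have "V\<^sup>2 / real m * 1 \<le> V\<^sup>2 / real m * (cb\<^sup>2 * cV * ln (real A / \<delta>))"
    by (rule mult_left_mono) simp
  then have "sqrt (V\<^sup>2 / real m) \<le> sqrt (cb\<^sup>2 * (cV * V\<^sup>2 * ln (real A / \<delta>) / real m))"
    by (intro real_sqrt_le_mono) (simp add: field_simps)
  then show ?thesis
    using assms by (simp add: penalty_def real_sqrt_divide real_sqrt_mult)
qed

text \<open>The third claim works with the unnormalised total noise on \<open>(s, a)\<close>, which
  is symmetric as a sum over all samples; no conditioning on the random number of visits is
  required. If it is nonpositive, the mean rating is at most its expectation, which the penalty
  absorbs.\<close>

lemma prob_lcb_reward_zero:
  assumes \<sigma>: "0 < \<sigma>"
    and h: "\<And>s a. h (r s a) \<in> borel_measurable borel"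
    and sym: "distr (gaussian \<sigma>) borel (\<lambda>e. - (h (r s a) e - hbar \<sigma> h (r s a))) =
      distr (gaussian \<sigma>) borel (\<lambda>e. h (r s a) e - hbar \<sigma> h (r s a))"
    and b: "\<And>m. 0 < m \<Longrightarrow> m \<le> n \<Longrightarrow> hbar \<sigma> h (r s a) \<le> b m"
  shows "prob_space (sample_space n d \<sigma>)"
    and "\<And>s' a'. (\<lambda>\<omega>. lcb_reward b n (rated_data h r \<omega>) s' a')
      \<in> borel_measurable (sample_space n d \<sigma>)"
    and "1 / 2 \<le> measure (sample_space n d \<sigma>)
      {\<omega> \<in> space (sample_space n d \<sigma>). lcb_reward b n (rated_data h r \<omega>) s a = 0}"
proof -
  let ?P = "measure_pmf d \<Otimes>\<^sub>M gaussian \<sigma>"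
  let ?M = "sample_space n d \<sigma>"
  \<comment> \<open>\<open>Y\<close> is the centred rating noise at \<open>(s, a)\<close>,
    \<open>g\<close> the contribution of one sample, and \<open>W\<close> the total noise over the
    visits to \<open>(s, a)\<close>.\<close>
  define Y where "Y e = h (r s a) e - hbar \<sigma> h (r s a)" for e
  define g where "g = (\<lambda>(z, e). indicator {(s, a)} z * Y e)"
  define W where "W \<omega> = (\<Sum>i\<in>{1..n}. g (\<omega> i))" for \<omega> :: "nat \<Rightarrow> (nat \<times> nat) \<times> real"
  have sets_gaussian [measurable_cong, simp]: "sets (gaussian \<sigma>) = sets borel"
    by (simp add: gaussian_def)
  have gaussian: "prob_space (gaussian \<sigma>)"
    unfolding gaussian_def using \<sigma> by (rule prob_space_normal_density)
  then interpret P: pair_prob_space "measure_pmf d" "gaussian \<sigma>"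
    by (intro pair_prob_space.intro pair_sigma_finite.intro)
      (auto intro: prob_space_imp_sigma_finite prob_space_measure_pmf)
  show M: "prob_space ?M"
    unfolding sample_space_def by (intro prob_space_PiM P.prob_space_axioms)
  then interpret M: prob_space ?M .
  note h [measurable]
  have Y: "Y \<in> borel_measurable (gaussian \<sigma>)"
    unfolding Y_def by measurable
  have g [measurable]: "g \<in> borel_measurable ?P"
  proof -
    have "(\<lambda>x. indicator {(s, a)} (fst x) :: real) \<in> borel_measurable ?P"
      by (rule measurable_compose[OF measurable_fst]) simp
    then show ?thesis
      unfolding g_def split_beta'
      by (intro borel_measurable_times measurable_compose[OF measurable_snd Y])
  qed
  have comp [measurable]: "(\<lambda>\<omega>. \<omega> i) \<in> ?M \<rightarrow>\<^sub>M ?P" if "i \<in> {1..n}" for i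
    unfolding sample_space_def using that by measurable
  \<comment> \<open>There are countably many state-action pairs, so measurability in the noise for
    each fixed pair suffices.\<close>
  have rating: "(\<lambda>x. h (r (fst (fst x)) (snd (fst x))) (snd x)) \<in> borel_measurable ?P"
  proof -
    have "(\<lambda>x. h (r (fst (fst x)) (snd (fst x))) (snd x))
        \<in> borel_measurable (count_space UNIV \<Otimes>\<^sub>M gaussian \<sigma>)"
      by (rule measurable_pair_measure_countable1) auto
    then show ?thesis
      by (simp cong: measurable_cong_sets sets_pair_measure_cong)
  qed
  show lcb [measurable]: "(\<lambda>\<omega>. lcb_reward b n (rated_data h r \<omega>) s' a') \<in> borel_measurable ?M"
    for s' a'
  proof (rule measurable_lcb_reward)
    fix i assume i: "i \<in> {1..n}"
    have "(\<lambda>\<omega>. fst (\<omega> i)) \<in> ?M \<rightarrow>\<^sub>M measure_pmf d"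
      using i by measurable
    then show "(\<lambda>\<omega>. fst (rated_data h r \<omega> i)) \<in> ?M \<rightarrow>\<^sub>M count_space UNIV"
      by (simp add: rated_data_def split_beta cong: measurable_cong_sets)
    show "(\<lambda>\<omega>. snd (rated_data h r \<omega> i)) \<in> borel_measurable ?M"
      using measurable_compose[OF comp[OF i] rating] by (simp add: rated_data_def split_beta)
  qed
  have W [measurable]: "W \<in> borel_measurable ?M"
    unfolding W_def by measurable
  have "distr ?P borel g = distr ?P borel (\<lambda>x. - g x)"
    using distr_pair_indicator_symmetric[OF prob_space_measure_pmf gaussian Y _ sym[folded Y_def, symmetric],
        of "{(s, a)}" d]
    by (simp add: g_def split_beta')
  then have "distr ?M borel W = distr ?M borel (\<lambda>\<omega>. - W \<omega>)"
    unfolding sample_space_def W_def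
    by (intro distr_PiM_sum_symmetric P.prob_space_axioms g) auto
  then have "1 / 2 \<le> M.prob {\<omega> \<in> space ?M. W \<omega> \<le> 0}"
    by (rule M.prob_nonpos_ge_half[OF W])
  also have "\<dots> \<le> M.prob {\<omega> \<in> space ?M. lcb_reward b n (rated_data h r \<omega>) s a = 0}"
  proof (rule M.finite_measure_mono)
    have "lcb_reward b n (rated_data h r \<omega>) s a = 0" if "W \<omega> \<le> 0" for \<omega>
    proof -
      let ?I = "{i\<in>{1..n}. fst (rated_data h r \<omega> i) = (s, a)}"
      let ?N = "count_sa n (rated_data h r \<omega>) s a"
      have "W \<omega> = (\<Sum>i\<in>?I. Y (snd (\<omega> i)))"
        unfolding W_def by (rule sum.mono_neutral_cong_right)
          (auto simp: g_def rated_data_def split_beta)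
      also have "\<dots> = (\<Sum>i\<in>?I. snd (rated_data h r \<omega> i) - hbar \<sigma> h (r s a))"
        by (rule sum.cong) (auto simp: Y_def rated_data_def split_beta)
      also have "\<dots> = (\<Sum>i\<in>?I. snd (rated_data h r \<omega> i)) - real ?N * hbar \<sigma> h (r s a)"
        by (simp add: sum_subtractf count_sa_def)
      finally have sum_le: "(\<Sum>i\<in>?I. snd (rated_data h r \<omega> i)) \<le> real ?N * hbar \<sigma> h (r s a)"
        using that by simp
      \<comment> \<open>Without visits the estimate is 0 by definition; otherwise dividing by the
        number of visits bounds the mean rating.\<close>
      show ?thesis
      proof (cases "?N = 0")
        case False
        then have "mean_rating n (rated_data h r \<omega>) s a \<le> hbar \<sigma> h (r s a)"
          using sum_le by (simp add: mean_rating_def field_simps)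
        also have "\<dots> \<le> b ?N"
        proof (rule b)
          have "card ?I \<le> card {1..n}"
            by (rule card_mono) auto
          then show "?N \<le> n"
            by (simp add: count_sa_def)
        qed (use False in simp)
        finally show ?thesis
          by (simp add: lcb_reward_def)
      qed (simp add: lcb_reward_def)
    qed
    then show "{\<omega> \<in> space ?M. W \<omega> \<le> 0} \<subseteq>
        {\<omega> \<in> space ?M. lcb_reward b n (rated_data h r \<omega>) s a = 0}"
      by blast
  qed measurable
  finally show "1 / 2 \<le> M.prob {\<omega> \<in> space ?M. lcb_reward b n (rated_data h r \<omega>) s a = 0}" .
qed

section \<open>The instance with one rewarding arm\<close>

lemma optimal_policy_single_arm:
  assumes "a1 \<in> {1..A}" and "0 \<le> x"
  shows "optimal_policy S A (\<lambda>s a. if a = a1 then x else 0) (\<lambda>s. return_pmf a1)"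
proof -
  have "measure_pmf.expectation p (\<lambda>a. if a = a1 then x else 0) \<le> x" for p
    using assms(2) by (intro measure_pmf.integral_le_const measure_pmf.integrable_const_bound[of _ x]) auto
  then show ?thesis
    using assms(1) by (auto simp: optimal_policy_def is_policy_def)
qed

text \<open>The loss is exactly \<open>x\<close> when \<open>a1\<close> is not chosen and 0
  otherwise. The expected loss is therefore \<open>x\<close> times the probability of missing
  \<open>a1\<close>, which is at least 1/2.\<close>

lemma expected_SubOpt_single_arm:
  assumes r: "r = (\<lambda>s a. if a = a1 then x else 0)" and x: "0 \<le> x"
    and tie: "tie_breaking tie" and a1: "a1 \<in> {1..A}" "a1 \<noteq> tie 1 {1..A}"
    and \<sigma>: "0 < \<sigma>"
    and h: "\<And>s a. h (r s a) \<in> borel_measurable borel"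
    and sym: "distr (gaussian \<sigma>) borel (\<lambda>e. - (h x e - hbar \<sigma> h x)) =
      distr (gaussian \<sigma>) borel (\<lambda>e. h x e - hbar \<sigma> h x)"
    and b: "\<And>m. 0 < m \<Longrightarrow> m \<le> n \<Longrightarrow> hbar \<sigma> h x \<le> b m"
  shows "x / 2 \<le> expected_SubOpt_lcb tie A (return_pmf 1) r (\<lambda>s. return_pmf a1) h \<sigma> d b n"
proof -
  let ?M = "sample_space n d \<sigma>"
  let ?L = "\<lambda>\<omega>. lcb_reward b n (rated_data h r \<omega>) 1"
  let ?T = "\<lambda>\<omega>. tie 1 {a. is_arg_max (?L \<omega>) (\<lambda>a. a \<in> {1..A}) a}"
  have rx: "r s a1 = x" for s
    by (simp add: r)
  note zero = prob_lcb_reward_zero[where \<sigma> = \<sigma> and h = h and r = r and s = 1 and a = a1 and n = n and b = b and d = d, unfolded rx, OF \<sigma> h sym b]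
  interpret prob_space ?M by (rule zero(1))
  note zero(2) [measurable]
  have T [measurable]: "?T \<in> ?M \<rightarrow>\<^sub>M count_space UNIV"
    by (rule measurable_compose[OF measurable_argmax_set]) auto
  define F where "F = {\<omega> \<in> space ?M. ?T \<omega> \<noteq> a1}"
  have F [measurable]: "F \<in> sets ?M"
    unfolding F_def by measurable
  have "1 / 2 \<le> prob {\<omega> \<in> space ?M. ?L \<omega> a1 = 0}"
    by (rule zero(3))
  also have "\<dots> \<le> prob F"
    using lcb_reward_zero_not_chosen[OF tie a1] F by (intro finite_measure_mono) (auto simp: F_def)
  finally have "x * (1 / 2) \<le> x * prob F"
    using x by (rule mult_left_mono)
  also have "\<dots> = expectation (\<lambda>\<omega>. x * indicator F \<omega>)"
    using F by simp
  also have "\<dots> = expected_SubOpt_lcb tie A (return_pmf 1) r (\<lambda>s. return_pmf a1) h \<sigma> d b n"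
    unfolding expected_SubOpt_lcb_def
    by (rule Bochner_Integration.integral_cong)
      (auto simp: SubOpt_def lcb_policy_def F_def r split: split_indicator)
  finally show ?thesis
    by simp
qed

section \<open>Choice of the reward level and of the number of arms\<close>

lemma hbar_inv_half_attained:
  assumes "0 \<le> R" "hbar \<sigma> h 0 = 0" "0 \<le> y"
  obtains x where "x \<in> {0..R}" "hbar \<sigma> h x \<le> y" "hbar_inv \<sigma> R h y / 2 \<le> x"
proof -
  let ?X = "{r\<in>{0..R}. hbar \<sigma> h r \<le> y}"
  have zero: "0 \<in> ?X"
    using assms by simp
  show ?thesis
  \<comment> \<open>A positive supremum strictly exceeds its half, so some admissible
    \<open>x\<close> lies above the half; otherwise \<open>x = 0\<close> will do.\<close>
  proof (cases "hbar_inv \<sigma> R h y \<le> 0")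
    case True
    then show ?thesis
      using that[of 0] zero by simp
  next
    case False
    then have "hbar_inv \<sigma> R h y / 2 < Sup ?X"
      by (simp add: hbar_inv_def)
    then obtain x where "x \<in> ?X" "hbar_inv \<sigma> R h y / 2 < x"
      using less_cSupD[of ?X] zero by blast
    then show ?thesis
      using that[of x] by simp
  qed
qed

theorem theorem2:
  fixes q :: nat
  shows "\<exists>c0 :: real. 0 < c0 \<and>
    (\<forall>(\<sigma> :: real) (R :: real) (h :: real \<Rightarrow> real \<Rightarrow> real) (C1 :: real) (C2 :: real) (V :: real)
       (cV :: real) (cb :: real) (\<delta> :: real) (tie :: nat \<Rightarrow> nat set \<Rightarrow> nat).
       rating_model q \<sigma> R h C1 C2 \<longrightarrow> variance_bound \<sigma> R h V \<longrightarrow>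
       0 < cV \<longrightarrow> 0 < cb \<longrightarrow> 0 < \<delta> \<longrightarrow> \<delta> < 1 \<longrightarrow> tie_breaking tie \<longrightarrow>
       (\<exists>(S :: nat) (A :: nat) (\<rho> :: nat pmf).
          \<forall>n :: nat. max (48 * \<sigma> ^ 4) 60 \<le> real n \<longrightarrow>
            (\<exists>r \<pi>opt. contextual_bandit S A R r \<rho> \<and> optimal_policy S A r \<pi>opt \<and>
               (\<forall>d :: (nat \<times> nat) pmf.
                  full_coverage S A d \<longrightarrow>
                  (\<forall>s\<in>{1..S}. \<forall>a\<in>{1..A}. pmf d (s, a) = 1 / real (S * A)) \<longrightarrow>
                  expected_SubOpt_lcb tie A \<rho> r \<pi>opt h \<sigma> d (penalty cb (cV * V\<^sup>2) S A \<delta>) n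
                    \<ge> c0 * hbar_inv \<sigma> R h (sqrt (V\<^sup>2 / real n))))))"
proof (intro exI[of _ "1 / 4"] conjI allI impI)
  fix \<sigma> R :: real and h :: "real \<Rightarrow> real \<Rightarrow> real" and C1 C2 V cV cb \<delta> :: real
    and tie :: "nat \<Rightarrow> nat set \<Rightarrow> nat"
  assume model: "rating_model q \<sigma> R h C1 C2" and cV: "0 < cV" and cb: "0 < cb"
    and \<delta>: "0 < \<delta>" "\<delta> < 1" and tie: "tie_breaking tie"
  have \<sigma>: "0 < \<sigma>" and R: "0 \<le> R" and hbar0: "hbar \<sigma> h 0 = 0"
    using model by (auto simp: rating_model_def)
  have h_meas: "h r \<in> borel_measurable borel" if r: "r \<in> {0..R}" for r
  proof -
    obtain p :: "real poly" where "h r = poly p"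
      using model r unfolding rating_model_def by blast
    then show ?thesis
      by (auto intro!: borel_measurable_continuous_onI continuous_intros)
  qed
  have sym: "distr (gaussian \<sigma>) borel (\<lambda>e. - (h r e - hbar \<sigma> h r)) =
      distr (gaussian \<sigma>) borel (\<lambda>e. h r e - hbar \<sigma> h r)" if "r \<in> {0..R}" for r
    using model that unfolding rating_model_def by blast
  \<comment> \<open>The exponential bound serves \<open>penalty_dominates\<close>; two arms leave
    one that differs from the choice of \<open>tie\<close>.\<close>
  obtain A :: nat where A: "max 2 (exp (1 / (cb\<^sup>2 * cV))) \<le> real A"
    using real_arch_simple by blast
  then have A2: "2 \<le> A" and A_exp: "exp (1 / (cb\<^sup>2 * cV)) \<le> real A"
    by auto
  define a1 :: nat where "a1 = (if tie 1 {1..A} = 1 then 2 else 1)"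
  have a1: "a1 \<in> {1..A}" "a1 \<noteq> tie 1 {1..A}"
    using A2 by (auto simp: a1_def)
  \<comment> \<open>\<open>A\<close> and \<open>a1\<close> are already fixed; only the reward level
    \<open>x\<close> varies with \<open>n\<close>.\<close>
  have hard_instance: "\<exists>r \<pi>opt. contextual_bandit 1 A R r (return_pmf 1) \<and> optimal_policy 1 A r \<pi>opt \<and>
      (\<forall>d. 1 / 4 * hbar_inv \<sigma> R h (sqrt (V\<^sup>2 / real n)) \<le>
        expected_SubOpt_lcb tie A (return_pmf 1) r \<pi>opt h \<sigma> d (penalty cb (cV * V\<^sup>2) 1 A \<delta>) n)"
    for n
  proof -
    obtain x where x: "x \<in> {0..R}" and hx: "hbar \<sigma> h x \<le> sqrt (V\<^sup>2 / real n)"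
      and half: "hbar_inv \<sigma> R h (sqrt (V\<^sup>2 / real n)) / 2 \<le> x"
      using hbar_inv_half_attained[OF R hbar0] by (metis divide_nonneg_nonneg of_nat_0_le_iff
          real_sqrt_ge_zero zero_le_power2)
    define r :: "nat \<Rightarrow> nat \<Rightarrow> real" where "r = (\<lambda>s a. if a = a1 then x else 0)"
    have bonus: "hbar \<sigma> h x \<le> penalty cb (cV * V\<^sup>2) 1 A \<delta> m" if "0 < m" "m \<le> n" for m
    proof -
      \<comment> \<open>At most \<open>n\<close> visits are possible, and fewer visits only enlarge
        this bound.\<close>
      have "sqrt (V\<^sup>2 / real n) \<le> \<bar>V\<bar> / sqrt (real m)"
        using that by (simp add: real_sqrt_divide divide_left_mono)
      also have "\<dots> \<le> penalty cb (cV * V\<^sup>2) 1 A \<delta> m"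
        using A2 A_exp cV cb \<delta> by (intro penalty_dominates) auto
      finally show ?thesis
        using hx by simp
    qed
    have "x / 2 \<le> expected_SubOpt_lcb tie A (return_pmf 1) r (\<lambda>s. return_pmf a1) h \<sigma> d
        (penalty cb (cV * V\<^sup>2) 1 A \<delta>) n" for d
      using x R bonus
      by (intro expected_SubOpt_single_arm[OF r_def _ tie a1 \<sigma>] h_meas sym) (auto simp: r_def)
    then have "1 / 4 * hbar_inv \<sigma> R h (sqrt (V\<^sup>2 / real n)) \<le>
        expected_SubOpt_lcb tie A (return_pmf 1) r (\<lambda>s. return_pmf a1) h \<sigma> d
          (penalty cb (cV * V\<^sup>2) 1 A \<delta>) n" for d
      by (rule order_trans[rotated]) (use half in simp)
    moreover have "contextual_bandit 1 A R r (return_pmf 1)"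
      using x R A2 by (auto simp: contextual_bandit_def r_def)
    moreover have "optimal_policy 1 A r (\<lambda>s. return_pmf a1)"
      unfolding r_def using x a1(1) by (intro optimal_policy_single_arm) auto
    ultimately show ?thesis
      by blast
  qed
  show "\<exists>S A \<rho>.
          \<forall>n :: nat. max (48 * \<sigma> ^ 4) 60 \<le> real n \<longrightarrow>
            (\<exists>r \<pi>opt. contextual_bandit S A R r \<rho> \<and> optimal_policy S A r \<pi>opt \<and>
               (\<forall>d :: (nat \<times> nat) pmf.
                  full_coverage S A d \<longrightarrow>
                  (\<forall>s\<in>{1..S}. \<forall>a\<in>{1..A}. pmf d (s, a) = 1 / real (S * A)) \<longrightarrow>
                  expected_SubOpt_lcb tie A \<rho> r \<pi>opt h \<sigma> d (penalty cb (cV * V\<^sup>2) S A \<delta>) n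
                    \<ge> 1 / 4 * hbar_inv \<sigma> R h (sqrt (V\<^sup>2 / real n))))"
    by (rule exI[of _ 1], rule exI[of _ A], rule exI[of _ "return_pmf 1"]) (use hard_instance in blast)
qed simp

end
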